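(* Let $X$ be a paracompact $C$-space and let $C$ be a convex subset of a Banach space. Suppose that to each $x\in X$ a $Z$-set $Z(x)$ of $C$ and a nonempty convex subset $U(x)$ of $C$ are assigned so that the set $\bigcup_{x\in X}\{x\}\times Z(x)$ is closed in $X\times C$ and the set $\bigcup_{x\in X}\{x\}\times U(x)$ is open in $X\times C$. Then there exists a continuous map $f:X\to C$ such that $f(x)\in U(x)\setminus Z(x)$ for every $x\in X$.
   Context: A space $X$ is a $C$-space (has property $C$) if for every sequence $\{\alpha_n:n\in\omega\}$ of open covers of $X$ there is a sequence $\{\mu_n:n\in\omega\}$, where each $\mu_n$ is a family of pairwise disjoint open subsets of $X$ refining $\alpha_n$, such that $\bigcup_{n\in\omega}\mu_n$ covers $X$. For topological spaces $K,T$, $C(K,T)$ denotes the space of continuous maps $K\to T$ with the compact-open topology. A closed subset $F$ of a topological space $T$ is a $Z$-set in $T$ if for every compact (Hausdorff) space $K$ the set $C(K,T\setminus F)$ is dense in $C(K,T)$. Here $C$ carries the norm topology. *)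

theory Defs
  imports "HOL-Analysis.Analysis"
begin

text \<open>Paracompact space (Hausdorff convention, as in Engelking): Hausdorff and every
  open cover has a locally finite open refinement covering the space.\<close>
definition paracompact_space :: "'x topology \<Rightarrow> bool" where
  "paracompact_space X \<longleftrightarrow> Hausdorff_space X \<and>
     (\<forall>\<U>. (\<forall>U\<in>\<U>. openin X U) \<and> topspace X \<subseteq> \<Union>\<U> \<longrightarrow>
        (\<exists>\<V>. (\<forall>V\<in>\<V>. openin X V) \<and> topspace X \<subseteq> \<Union>\<V> \<and>
              (\<forall>V\<in>\<V>. \<exists>U\<in>\<U>. V \<subseteq> U) \<and> locally_finite_in X \<V>))"

definition C_space :: "'x topology \<Rightarrow> bool" where
  "C_space X \<longleftrightarrow>
     (\<forall>\<alpha> :: nat \<Rightarrow> 'x set set.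
        (\<forall>n. (\<forall>U\<in>\<alpha> n. openin X U) \<and> topspace X \<subseteq> \<Union>(\<alpha> n)) \<longrightarrow>
        (\<exists>\<mu> :: nat \<Rightarrow> 'x set set.
           (\<forall>n. (\<forall>V\<in>\<mu> n. openin X V) \<and> pairwise disjnt (\<mu> n) \<and>
                (\<forall>V\<in>\<mu> n. \<exists>U\<in>\<alpha> n. V \<subseteq> U)) \<and>
           topspace X \<subseteq> (\<Union>n. \<Union>(\<mu> n))))"

text \<open>A set S of maps K \<rightarrow> T is dense in C(K,T) with the compact-open topology:
  every basic open set [A_1,V_1] \<inter> ... \<inter> [A_m,V_m] (A_i compact in K, V_i open in T)
  containing a continuous map g contains a member of S.\<close>
definition compact_open_dense :: "'k topology \<Rightarrow> 'b topology \<Rightarrow> ('k \<Rightarrow> 'b) set \<Rightarrow> bool" where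
  "compact_open_dense K T S \<longleftrightarrow>
     (\<forall>g P. continuous_map K T g \<and> finite P \<and>
            (\<forall>(A,V)\<in>P. compactin K A \<and> openin T V \<and> g ` A \<subseteq> V) \<longrightarrow>
            (\<exists>h\<in>S. \<forall>(A,V)\<in>P. h ` A \<subseteq> V))"

definition Z_set_in :: "'b topology \<Rightarrow> 'b set \<Rightarrow> bool" where
  "Z_set_in T F \<longleftrightarrow> closedin T F \<and>
     (\<forall>K :: (real \<Rightarrow> real) topology. compact_space K \<and> Hausdorff_space K \<longrightarrow>
        compact_open_dense K T {h. continuous_map K (subtopology T (topspace T - F)) h})"

end

theory Submission
  imports Defs
begin

text \<open>
  A compact subset \<open>K\<close> of \<open>V x = U x - Z x\<close> can be contracted inside \<open>V x\<close>: form the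
  cone over \<open>K\<close> in \<open>U x\<close> and move it off \<open>Z x\<close> by a small perturbation \<open>h\<close>; near \<open>K\<close> the
  segments from \<open>y\<close> to \<open>h y\<close> stay in \<open>V x\<close>. As the graph of \<open>V\<close> is open, the same
  contraction works over a neighbourhood of \<open>x\<close>.

  Starting from \<open>Q 0 x = {}\<close>, one builds increasing compact sets \<open>Q n x \<subseteq> V x\<close>, locally
  decreasing in \<open>x\<close>, such that over a small neighbourhood \<open>W\<close> of each point all the sets
  \<open>Q n x\<close> are contracted to a point, by one and the same map, inside every \<open>Q (n + 1) x\<close>.
  These sets do not depend on the disjoint families supplied by property C, so the latter
  can be applied once, to the sequence of covers by such \<open>W\<close>. With bump
  functions \<open>s n\<close> supported in the union of the \<open>n\<close>-th disjoint family, a partial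
  selection with values in \<open>Q n\<close> is moved at step \<open>n\<close> along the contraction for time
  \<open>s n x\<close>. Where \<open>s n x = 1\<close> the new value is the apex, whatever the old one was, so the
  selection becomes defined there. By local finiteness this process is locally stationary.
\<close>

section \<open>Approximation off a Z-set and contraction of compact sets\<close>

text \<open>Test spaces of Z-sets carry the type \<open>real \<Rightarrow> real\<close>; the compact set \<open>Q\<close> is embedded there by
  its distances to a countable dense set, so that the inclusion of \<open>Q\<close> can be approximated.\<close>
lemma Z_set_in_compact_approx:
  fixes C :: "'a::metric_space set"
  assumes Z: "Z_set_in (top_of_set C) F" and Q: "compact Q" "Q \<subseteq> C" and e: "0 < e"
  obtains h where "continuous_on Q h" "h ` Q \<subseteq> C - F" "\<And>y. y \<in> Q \<Longrightarrow> dist (h y) y < e"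
proof -
  have net: "\<exists>k. finite k \<and> Q \<subseteq> (\<Union>x\<in>k. ball x d)" if "d > 0" for d
    using Q(1) that unfolding compact_eq_totally_bounded by blast
  then obtain k where k: "\<And>d. d > 0 \<Longrightarrow> finite (k d) \<and> Q \<subseteq> (\<Union>x\<in>k d. ball x d)"
    by metis
  \<comment> \<open>The net points need not belong to \<open>Q\<close>; it is enough that
    \<open>D\<close> is countable and comes arbitrarily close to every point of
    \<open>Q\<close>.\<close>
  define D where "D = (\<Union>n. k (1 / Suc n))"
  have cD: "countable D"
    unfolding D_def using k by (intro countable_UN) (auto intro!: countable_finite)
  \<comment> \<open>The coordinates are indexed by reals to meet the type of test spaces. Rounding
    \<open>r\<close> down to a natural number makes the coordinate \<open>real n\<close> the
    distance to the \<open>n\<close>-th point of \<open>D\<close>.\<close>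
  define \<iota> where "\<iota> = (\<lambda>y (r::real). dist y (from_nat_into D (nat \<lfloor>r\<rfloor>)))"
  have cont: "continuous_on Q \<iota>"
    unfolding \<iota>_def by (intro continuous_on_coordinatewise_then_product continuous_intros)
  have inj: "inj_on \<iota> Q"
  proof (rule inj_onI, rule ccontr)
    fix y z assume yz: "y \<in> Q" "z \<in> Q" "\<iota> y = \<iota> z" "y \<noteq> z"
    \<comment> \<open>A point closer to \<open>y\<close> than half of \<open>dist y z\<close> cannot
      be equidistant from \<open>y\<close> and \<open>z\<close>, so some coordinate separates
      them.\<close>
    then obtain n where n: "1 / Suc n < dist y z / 2"
      by (metis half_gt_zero nat_approx_posE zero_less_dist_iff)
    obtain q where q: "q \<in> k (1 / Suc n)" "dist q y < 1 / Suc n"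
      using k[of "1 / Suc n"] yz(1) by auto
    then have "q \<in> D" unfolding D_def by blast
    then obtain m where m: "q = from_nat_into D m"
      using cD by (metis from_nat_into_surj)
    have "dist y q = dist z q"
      using fun_cong[OF yz(3), of "real m"] by (simp add: \<iota>_def m)
    then show False
      using q n dist_triangle[of y z q] by (simp add: dist_commute)
  qed
  let ?K = "top_of_set (\<iota> ` Q)"
  have comp: "compact_space ?K"
    using Q(1) cont by (simp add: compact_space_subtopology compact_continuous_image)
  have "Hausdorff_space (euclidean :: (real \<Rightarrow> real) topology)"
    by (simp add: euclidean_product_topology[symmetric] Hausdorff_space_product_topology)
  then have haus: "Hausdorff_space ?K"
    by (rule Hausdorff_space_subtopology)
  have "homeomorphic_map (top_of_set Q) ?K \<iota>"
    using Q(1) cont inj haus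
    by (intro continuous_imp_homeomorphic_map) (auto simp: compact_space_subtopology)
  then obtain g where "homeomorphic_maps (top_of_set Q) ?K \<iota> g"
    unfolding homeomorphic_map_maps by blast
  then have g: "continuous_on (\<iota> ` Q) g" "\<And>y. y \<in> Q \<Longrightarrow> g (\<iota> y) = y"
    unfolding homeomorphic_maps_def by auto
  \<comment> \<open>A neighbourhood of \<open>g\<close>, the inverse of \<open>\<iota>\<close>, in
    the compact-open topology: pieces of \<open>Q\<close> in closed balls of radius
    \<open>e/3\<close> are to be sent into open balls of radius \<open>e/2\<close> about the same
    centre. Any \<open>h\<close> in it differs from \<open>g\<close> by less than
    \<open>e/3 + e/2 < e\<close>.\<close>
  define P where "P = (\<lambda>q. (\<iota> ` (Q \<inter> cball q (e/3)), C \<inter> ball q (e/2))) ` k (e/3)"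
  have contg: "continuous_map ?K (top_of_set C) g"
    using g Q(2) by auto
  have PP: "\<forall>(A,V)\<in>P. compactin ?K A \<and> openin (top_of_set C) V \<and> g ` A \<subseteq> V"
  proof -
    have "compactin ?K (\<iota> ` (Q \<inter> cball q (e/3))) \<and> openin (top_of_set C) (C \<inter> ball q (e/2)) \<and> g ` \<iota> ` (Q \<inter> cball q (e/3)) \<subseteq> C \<inter> ball q (e/2)" for q
    proof (intro conjI)
      have "compact (Q \<inter> cball q (e/3))" using Q(1) by (simp add: compact_Int_closed)
      then show "compactin ?K (\<iota> ` (Q \<inter> cball q (e/3)))"
        using continuous_on_subset[OF cont]
        by (auto simp: compactin_subtopology intro!: compact_continuous_image)
      show "g ` \<iota> ` (Q \<inter> cball q (e/3)) \<subseteq> C \<inter> ball q (e/2)"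
        using g Q(2) e by auto
    qed auto
    then show ?thesis unfolding P_def by auto
  qed
  have finP: "finite P" unfolding P_def using k[of "e/3"] e by simp
  have dense: "compact_open_dense ?K (top_of_set C)
      {h. continuous_map ?K (subtopology (top_of_set C) (topspace (top_of_set C) - F)) h}"
    using Z comp haus unfolding Z_set_in_def by blast
  obtain h where h0: "h \<in> {h. continuous_map ?K (subtopology (top_of_set C) (topspace (top_of_set C) - F)) h}"
    and h: "\<forall>(A,V)\<in>P. h ` A \<subseteq> V"
    using dense[unfolded compact_open_dense_def, rule_format, of g P, OF conjI[OF contg conjI[OF finP PP]]] by (rule bexE)
  have h1: "continuous_on (\<iota> ` Q) h" "h ` \<iota> ` Q \<subseteq> C - F"
    using h0 by (auto simp: continuous_map_in_subtopology)
  show thesis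
  proof (rule that[of "h \<circ> \<iota>"])
    show "continuous_on Q (h \<circ> \<iota>)" using cont h1(1) by (rule continuous_on_compose)
    show "(h \<circ> \<iota>) ` Q \<subseteq> C - F" using h1(2) by auto
    fix y assume "y \<in> Q"
    then obtain q where q: "q \<in> k (e/3)" "dist q y < e/3" using k[of "e/3"] e by auto
    then have "h ` \<iota> ` (Q \<inter> cball q (e/3)) \<subseteq> C \<inter> ball q (e/2)"
      using h unfolding P_def by auto
    moreover have "h (\<iota> y) \<in> h ` \<iota> ` (Q \<inter> cball q (e/3))" using \<open>y \<in> Q\<close> q by auto
    ultimately have "h (\<iota> y) \<in> ball q (e/2)" by blast
    then have "dist q (h (\<iota> y)) < e/2" by simp
    then show "dist ((h \<circ> \<iota>) y) y < e"
      using q dist_triangle[of "h (\<iota> y)" y q] e by (simp add: dist_commute)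
  qed
qed

lemma compact_relative_ball:
  fixes K :: "'a::metric_space set"
  assumes "compact K" "K \<subseteq> S" "openin (top_of_set C) S"
  obtains d where "0 < d" "\<And>x y. \<lbrakk>x \<in> K; y \<in> C; dist x y < d\<rbrakk> \<Longrightarrow> y \<in> S"
proof -
  obtain T where T: "open T" "S = C \<inter> T" using assms(3) by (auto simp: openin_open)
  then obtain d where "0 < d" "(\<Union>x\<in>K. ball x d) \<subseteq> T"
    using compact_subset_open_imp_ball_epsilon_subset[OF assms(1), of T] assms(2) by blast
  then show thesis using that[of d] T by (auto simp: subset_iff)
qed

text \<open>The cone over \<open>Q\<close> lies in \<open>U\<close> by convexity but may meet
  \<open>F\<close>, so it is replaced by its image under a map \<open>h\<close> into
  \<open>C - F\<close> close to the identity. During the first half of the time \<open>y\<close>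
  travels straight to \<open>h y\<close>; during the second half \<open>h\<close> is applied to the
  cone, which ends at \<open>h u\<close>.\<close>

lemma Z_set_in_convex_contraction:
  fixes C :: "'a::real_normed_vector set"
  assumes C: "convex C" and Z: "Z_set_in (top_of_set C) F"
    and U: "convex U" "U \<noteq> {}" "openin (top_of_set C) U"
    and Q: "compact Q" "Q \<subseteq> U - F"
  obtains c a where "continuous_on (Q \<times> {0..1::real}) c" "c ` (Q \<times> {0..1}) \<subseteq> U - F" "a \<in> U - F"
    "\<And>y. y \<in> Q \<Longrightarrow> c (y, 0) = y" "\<And>y. y \<in> Q \<Longrightarrow> c (y, 1) = a"
proof -
  have UC: "U \<subseteq> C" using U(3) openin_imp_subset by blast
  have V: "openin (top_of_set C) (U - F)"
    using U(3) Z unfolding Z_set_in_def by (intro openin_diff) auto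
  obtain u where u: "u \<in> U" using U(2) by blast
  define cone where "cone = (\<lambda>(y, t::real). (1 - t) *\<^sub>R y + t *\<^sub>R u)"
  have contcone: "continuous_on S cone" for S
    unfolding cone_def case_prod_unfold by (intro continuous_intros)
  \<comment> \<open>Inserting \<open>u\<close> guarantees \<open>u \<in> R\<close> even when
    \<open>Q\<close> is empty, so that the apex \<open>h u\<close> is available.\<close>
  define R where "R = cone ` (insert u Q \<times> {0..1})"
  have R: "compact R" 
    unfolding R_def using Q(1) by (intro compact_continuous_image contcone compact_Times) auto
  have RU: "R \<subseteq> U"
    unfolding R_def cone_def using u Q(2) U(1)
    by (auto intro!: convexD_alt[OF U(1)])
  have uR: "u \<in> R"
    unfolding R_def by (rule image_eqI[of _ _ "(u, 0)"]) (auto simp: cone_def)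
  have QR: "Q \<subseteq> R"
  proof
    fix y assume "y \<in> Q"
    then show "y \<in> R" unfolding R_def by (intro image_eqI[of _ _ "(y, 0)"]) (auto simp: cone_def)
  qed
  obtain d1 where d1: "0 < d1" "\<And>x y. \<lbrakk>x \<in> R; y \<in> C; dist x y < d1\<rbrakk> \<Longrightarrow> y \<in> U"
    using compact_relative_ball[OF R RU U(3)] by blast
  obtain d2 where d2: "0 < d2" "\<And>x y. \<lbrakk>x \<in> Q; y \<in> C; dist x y < d2\<rbrakk> \<Longrightarrow> y \<in> U - F"
    using compact_relative_ball[OF Q V] by blast
  obtain h where h: "continuous_on R h" "h ` R \<subseteq> C - F" "\<And>y. y \<in> R \<Longrightarrow> dist (h y) y < min d1 d2"
  proof (rule Z_set_in_compact_approx[OF Z R])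
    show "R \<subseteq> C" using RU UC by blast
    show "0 < min d1 d2" using d1(1) d2(1) by simp
  qed blast
  have hR: "h y \<in> U - F" if "y \<in> R" for y
  proof -
    have "dist y (h y) < d1" using h(3)[OF that] by (simp add: dist_commute)
    then show ?thesis using d1(2)[OF that] h(2) that by blast
  qed
  define c1 c2 where "c1 = (\<lambda>(y, t). (1 - 2*t) *\<^sub>R y + (2*t) *\<^sub>R h y)"
    and "c2 = (\<lambda>(y, t). h (cone (y, 2*t - 1)))"
  define c where "c = (\<lambda>p. if snd p \<le> 1/2 then c1 p else c2 p)"
  have split: "Q \<times> {0..1} = Q \<times> {0..1/2} \<union> Q \<times> {1/2..1::real}" by auto
  have conth: "continuous_on (Q \<times> S) (\<lambda>p. h (fst p))" for S :: "real set"
    by (rule continuous_on_compose2[OF h(1)]) (use QR in \<open>auto intro!: continuous_intros\<close>)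
  have cont1: "continuous_on (Q \<times> {0..1/2}) c1"
    unfolding c1_def case_prod_unfold by (intro continuous_intros conth)
  have contdbl: "continuous_on S (\<lambda>p. (fst p, 2 * snd p - 1))" for S :: "('a \<times> real) set"
    by (intro continuous_intros)
  have "continuous_on (Q \<times> {1/2..1}) (\<lambda>p. cone (fst p, 2 * snd p - 1))"
    by (rule continuous_on_compose2[OF contcone[of UNIV] contdbl]) auto
  moreover have "(\<lambda>p. cone (fst p, 2 * snd p - 1)) ` (Q \<times> {1/2..1}) \<subseteq> R"
    unfolding R_def by auto
  ultimately have cont2: "continuous_on (Q \<times> {1/2..1}) c2"
    unfolding c2_def case_prod_unfold by (rule continuous_on_compose2[OF h(1)])
  have mid: "c1 (y, 1/2) = c2 (y, 1/2)" for y
    by (simp add: c1_def c2_def cone_def)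
  have cc: "continuous_on (Q \<times> {0..1}) c"
    unfolding split c_def
  proof (rule continuous_on_If[OF _ _ cont1 cont2])
    show "closed (Q \<times> {0..1/2::real})" "closed (Q \<times> {1/2..1::real})"
      using Q(1) by (auto intro: closed_Times compact_imp_closed)
    show "c1 p = c2 p" if "p \<in> Q \<times> {0..1/2}" "\<not> snd p \<le> 1/2" for p
      using that by auto
    show "c1 p = c2 p" if "p \<in> Q \<times> {1/2..1}" "snd p \<le> 1/2" for p
    proof -
      from that obtain y where "p = (y, 1/2)" by (cases p) auto
      then show ?thesis using mid by simp
    qed
  qed
  show thesis
  proof (rule that[of c "h u"])
    show "continuous_on (Q \<times> {0..1}) c" by (fact cc)
    show "h u \<in> U - F" using hR uR .
    show "c (y, 0) = y" for y by (simp add: c_def c1_def)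
    show "c (y, 1) = h u" for y by (simp add: c_def c2_def cone_def)
    have "c (y, t) \<in> U - F" if "y \<in> Q" "0 \<le> t" "t \<le> 1" for y t
    proof (cases "t \<le> 1/2")
      case True
      let ?z = "(1 - 2*t) *\<^sub>R y + (2*t) *\<^sub>R h y"
      have y: "y \<in> R" using that QR by blast
      have "?z \<in> C" using C that True y hR[OF y] UC RU by (intro convexD_alt) auto
      moreover have "y - ?z = (2*t) *\<^sub>R (y - h y)" by (simp add: algebra_simps)
      then have "dist y ?z = 2*t * dist y (h y)" using that by (simp add: dist_norm)
      then have "dist y ?z \<le> dist y (h y)" using True that
        by (simp add: mult_left_le_one_le)
      then have "dist y ?z < d2" using h(3)[OF y] by (simp add: dist_commute)
      ultimately have "?z \<in> U - F" using d2(2) that by blast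
      then show ?thesis using True by (simp add: c_def c1_def)
    next
      case False
      then have "cone (y, 2*t - 1) \<in> R" unfolding R_def using that by auto
      then show ?thesis using hR False by (simp add: c_def c2_def)
    qed
    then show "c ` (Q \<times> {0..1}) \<subseteq> U - F" by auto
  qed
qed

section \<open>Separation, shrinking and bump functions in paracompact spaces\<close>

lemma paracompact_space_refinement:
  assumes X: "paracompact_space X" and \<U>: "\<And>U. U \<in> \<U> \<Longrightarrow> openin X U" "topspace X \<subseteq> \<Union>\<U>"
  shows "\<exists>\<V>. (\<forall>V\<in>\<V>. openin X V) \<and> topspace X \<subseteq> \<Union>\<V> \<and> (\<forall>V\<in>\<V>. \<exists>U\<in>\<U>. V \<subseteq> U) \<and>
    locally_finite_in X \<V>"
  using X[unfolded paracompact_space_def, THEN conjunct2, rule_format, of \<U>] \<U> by simp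

text \<open>The common core of regularity and normality. In a locally finite refinement, the members
  meeting \<open>S\<close> lie in open sets separated from \<open>T\<close>, so their closures miss
  \<open>T\<close>. By local finiteness the closure of their union is the union of these closures
  and misses \<open>T\<close> too.\<close>

lemma paracompact_space_separate:
  assumes X: "paracompact_space X" and S: "closedin X S" and T: "T \<subseteq> topspace X"
    and sep: "\<And>y. y \<in> S \<Longrightarrow> \<exists>A B. openin X A \<and> openin X B \<and> y \<in> A \<and> T \<subseteq> B \<and> disjnt A B"
  shows "\<exists>A B. openin X A \<and> openin X B \<and> S \<subseteq> A \<and> T \<subseteq> B \<and> disjnt A B"
proof -
  define \<A> where "\<A> = {A. openin X A \<and> (\<exists>B. openin X B \<and> T \<subseteq> B \<and> disjnt A B)}"
  have "\<exists>\<V>. (\<forall>V\<in>\<V>. openin X V) \<and> topspace X \<subseteq> \<Union>\<V> \<and>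
      (\<forall>V\<in>\<V>. \<exists>U\<in>insert (topspace X - S) \<A>. V \<subseteq> U) \<and> locally_finite_in X \<V>"
    by (rule paracompact_space_refinement[OF X]) (use S sep in \<open>auto simp: \<A>_def\<close>)
  then obtain \<V> where \<V>: "\<forall>V\<in>\<V>. openin X V" "topspace X \<subseteq> \<Union>\<V>"
    "\<forall>V\<in>\<V>. \<exists>U\<in>insert (topspace X - S) \<A>. V \<subseteq> U" "locally_finite_in X \<V>"
    by blast
  define \<W> where "\<W> = {V \<in> \<V>. V \<inter> S \<noteq> {}}"
  have lf: "locally_finite_in X \<W>"
    using \<V>(4) by (rule locally_finite_in_subset) (auto simp: \<W>_def)
  have "disjnt T (X closure_of W)" if W: "W \<in> \<W>" for W
  proof -
    obtain A where "A \<in> \<A>" "W \<subseteq> A" using W \<V>(3) unfolding \<W>_def by blast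
    then obtain B where B: "openin X B" "T \<subseteq> B" "B \<inter> W = {}"
      unfolding \<A>_def disjnt_def by blast
    then have "B \<inter> X closure_of W = {}"
      by (simp add: openin_Int_closure_of_eq_empty)
    then show ?thesis using B(2) by (auto simp: disjnt_def)
  qed
  then have disj: "disjnt T (X closure_of \<Union>\<W>)"
    unfolding closure_of_locally_finite_Union[OF lf] disjnt_def by blast
  have op: "openin X (\<Union>\<W>)" using \<V>(1) unfolding \<W>_def by blast
  show ?thesis
  proof (rule exI[of _ "\<Union>\<W>"], rule exI[of _ "topspace X - X closure_of \<Union>\<W>"], intro conjI)
    show "openin X (topspace X - X closure_of \<Union>\<W>)" by (intro openin_diff) auto
    show "S \<subseteq> \<Union>\<W>"
      using \<V>(2) closedin_subset[OF S] unfolding \<W>_def by blast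
    show "T \<subseteq> topspace X - X closure_of \<Union>\<W>" using T disj by (auto simp: disjnt_def)
    show "disjnt (\<Union>\<W>) (topspace X - X closure_of \<Union>\<W>)"
      using closure_of_subset[OF openin_subset[OF op]] by (auto simp: disjnt_def)
  qed (fact op)
qed

lemma paracompact_imp_regular_space:
  assumes X: "paracompact_space X"
  shows "regular_space X"
  unfolding regular_space_def
proof (intro allI impI, elim conjE)
  fix S a assume S: "closedin X S" and a: "a \<in> topspace X - S"
  have "\<exists>A B. openin X A \<and> openin X B \<and> y \<in> A \<and> {a} \<subseteq> B \<and> disjnt A B" if "y \<in> S" for y
  proof -
    have "y \<in> topspace X" "y \<noteq> a" using closedin_subset[OF S] that a by auto
    moreover have "Hausdorff_space X" using X unfolding paracompact_space_def by (rule conjunct1)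
    ultimately show ?thesis using a unfolding Hausdorff_space_def by simp
  qed
  then have "\<exists>A B. openin X A \<and> openin X B \<and> S \<subseteq> A \<and> {a} \<subseteq> B \<and> disjnt A B"
    by (intro paracompact_space_separate[OF X S]) (use a in auto)
  then show "\<exists>U V. openin X U \<and> openin X V \<and> a \<in> U \<and> S \<subseteq> V \<and> disjnt U V"
    by (simp add: disjnt_sym) (meson disjnt_sym)
qed

lemma paracompact_imp_normal_space:
  assumes X: "paracompact_space X"
  shows "normal_space X"
  unfolding normal_space_def
proof (intro allI impI, elim conjE)
  fix S T assume S: "closedin X S" and T: "closedin X T" and disj: "disjnt S T"
  show "\<exists>A B. openin X A \<and> openin X B \<and> S \<subseteq> A \<and> T \<subseteq> B \<and> disjnt A B"
  proof (rule paracompact_space_separate[OF X S closedin_subset[OF T]])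
    fix y assume "y \<in> S"
    then have "y \<in> topspace X - T" using closedin_subset[OF S] disj by (auto simp: disjnt_iff)
    then show "\<exists>A B. openin X A \<and> openin X B \<and> y \<in> A \<and> T \<subseteq> B \<and> disjnt A B"
      using paracompact_imp_regular_space[OF X] T unfolding regular_space_def by blast
  qed
qed

text \<open>Regularity gives each point a neighbourhood whose closure lies in its
  \<open>G x\<close>; these neighbourhoods are then refined.\<close>

lemma paracompact_space_closure_refinement:
  assumes X: "paracompact_space X"
    and G: "\<And>x. x \<in> topspace X \<Longrightarrow> openin X (G x) \<and> x \<in> G x"
  obtains \<V> where "\<And>V. V \<in> \<V> \<Longrightarrow> openin X V" "topspace X \<subseteq> \<Union>\<V>" "locally_finite_in X \<V>"
    "\<And>V. V \<in> \<V> \<Longrightarrow> \<exists>x\<in>topspace X. X closure_of V \<subseteq> G x"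
proof -
  have nb: "neighbourhood_base_of (closedin X) X"
    using paracompact_imp_regular_space[OF X] by (simp add: neighbourhood_base_of_closedin)
  define \<U> where "\<U> = {U. openin X U \<and> (\<exists>x\<in>topspace X. X closure_of U \<subseteq> G x)}"
  have "topspace X \<subseteq> \<Union>\<U>"
  proof
    fix x assume x: "x \<in> topspace X"
    then obtain U V where "openin X U" "closedin X V" "x \<in> U" "U \<subseteq> V" "V \<subseteq> G x"
      using nb G[OF x] unfolding neighbourhood_base_of by metis
    then show "x \<in> \<Union>\<U>"
      using x closure_of_minimal[of U V X] unfolding \<U>_def by blast
  qed
  then have "\<exists>\<V>. (\<forall>V\<in>\<V>. openin X V) \<and> topspace X \<subseteq> \<Union>\<V> \<and>
      (\<forall>V\<in>\<V>. \<exists>U\<in>\<U>. V \<subseteq> U) \<and> locally_finite_in X \<V>"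
    by (intro paracompact_space_refinement[OF X]) (simp_all add: \<U>_def)
  then obtain \<V> where \<V>: "\<forall>V\<in>\<V>. openin X V" "topspace X \<subseteq> \<Union>\<V>" "\<forall>V\<in>\<V>. \<exists>U\<in>\<U>. V \<subseteq> U" "locally_finite_in X \<V>"
    by blast
  show thesis
  proof (rule that[of \<V>])
    fix V assume "V \<in> \<V>"
    then obtain U where "V \<subseteq> U" "U \<in> \<U>" using \<V>(3) by blast
    then show "\<exists>x\<in>topspace X. X closure_of V \<subseteq> G x"
      using closure_of_mono[OF \<open>V \<subseteq> U\<close>, of X] unfolding \<U>_def by blast
  qed (use \<V> in auto)
qed

text \<open>A locally finite refinement is regrouped by assigning to each member one index
  \<open>k V\<close>. Closures commute with locally finite unions, so \<open>B i\<close> inherits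
  the closure condition from its members.\<close>

lemma paracompact_space_shrink:
  fixes G :: "'i \<Rightarrow> 'x set"
  assumes X: "paracompact_space X" and G: "\<And>i. openin X (G i)" "topspace X \<subseteq> (\<Union>i. G i)"
  obtains B where "\<And>i. openin X (B i)" "\<And>i. X closure_of (B i) \<subseteq> G i" "topspace X \<subseteq> (\<Union>i. B i)"
    "\<And>x. x \<in> topspace X \<Longrightarrow> \<exists>N. openin X N \<and> x \<in> N \<and> finite {i. B i \<inter> N \<noteq> {}}"
proof -
  have "\<exists>i. x \<in> G i" if "x \<in> topspace X" for x
    using G(2) that by blast
  then obtain j where j: "\<And>x. x \<in> topspace X \<Longrightarrow> x \<in> G (j x)"
    by metis
  obtain \<V> where \<V>: "\<And>V. V \<in> \<V> \<Longrightarrow> openin X V" "topspace X \<subseteq> \<Union>\<V>" "locally_finite_in X \<V>"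
    "\<And>V. V \<in> \<V> \<Longrightarrow> \<exists>x\<in>topspace X. X closure_of V \<subseteq> G (j x)"
  proof (rule paracompact_space_closure_refinement[OF X, of "\<lambda>x. G (j x)"])
    show "openin X (G (j x)) \<and> x \<in> G (j x)" if "x \<in> topspace X" for x
      using G(1) j[OF that] by blast
  qed (rule that)
  have "\<exists>i. X closure_of V \<subseteq> G i" if "V \<in> \<V>" for V
    using \<V>(4)[OF that] by blast
  then obtain k where k: "\<And>V. V \<in> \<V> \<Longrightarrow> X closure_of V \<subseteq> G (k V)"
    by metis
  define B where "B = (\<lambda>i. \<Union>{V \<in> \<V>. k V = i})"
  show thesis
  proof (rule that[of B])
    show "openin X (B i)" for i using \<V>(1) unfolding B_def by blast
    show "X closure_of (B i) \<subseteq> G i" for i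
    proof -
      have "locally_finite_in X {V \<in> \<V>. k V = i}"
        using \<V>(3) by (rule locally_finite_in_subset) auto
      then show ?thesis unfolding B_def using k by (auto simp: closure_of_locally_finite_Union)
    qed
    show "topspace X \<subseteq> (\<Union>i. B i)" using \<V>(2) unfolding B_def by blast
    fix x assume "x \<in> topspace X"
    then obtain N where N: "openin X N" "x \<in> N" "finite {V \<in> \<V>. V \<inter> N \<noteq> {}}"
      using \<V>(3) unfolding locally_finite_in_def by blast
    have "{i. B i \<inter> N \<noteq> {}} \<subseteq> k ` {V \<in> \<V>. V \<inter> N \<noteq> {}}" unfolding B_def by blast
    then show "\<exists>N. openin X N \<and> x \<in> N \<and> finite {i. B i \<inter> N \<noteq> {}}"
      using N finite_surj by blast
  qed
qed

text \<open>Shrinking twice leaves room for Urysohn functions: \<open>s i\<close> vanishes off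
  \<open>B i\<close> and is 1 on the closure of \<open>B' i\<close>. The sets where the value 1 is
  attained therefore still cover, and local finiteness comes from \<open>B\<close>.\<close>

lemma paracompact_space_bump_functions:
  fixes G :: "'i \<Rightarrow> 'x set"
  assumes X: "paracompact_space X" and G: "\<And>i. openin X (G i)" "topspace X \<subseteq> (\<Union>i. G i)"
  obtains s :: "'i \<Rightarrow> 'x \<Rightarrow> real" where
    "\<And>i. continuous_map X (top_of_set {0..1}) (s i)"
    "\<And>i. X closure_of {x \<in> topspace X. s i x \<noteq> 0} \<subseteq> G i"
    "\<And>x. x \<in> topspace X \<Longrightarrow> \<exists>i. s i x = 1"
    "\<And>x. x \<in> topspace X \<Longrightarrow> \<exists>N. openin X N \<and> x \<in> N \<and> finite {i. \<exists>y\<in>N. s i y \<noteq> 0}"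
proof -
  obtain B where B: "\<And>i. openin X (B i)" "\<And>i. X closure_of (B i) \<subseteq> G i" "topspace X \<subseteq> (\<Union>i. B i)"
    "\<And>x. x \<in> topspace X \<Longrightarrow> \<exists>N. openin X N \<and> x \<in> N \<and> finite {i. B i \<inter> N \<noteq> {}}"
    by (rule paracompact_space_shrink[OF X G]) (rule that)
  obtain B' where B': "\<And>i. openin X (B' i)" "\<And>i. X closure_of (B' i) \<subseteq> B i" "topspace X \<subseteq> (\<Union>i. B' i)"
    by (rule paracompact_space_shrink[OF X B(1,3)]) (rule that)
  have "\<exists>s. continuous_map X (top_of_set {0..1::real}) s \<and> s ` (topspace X - B i) \<subseteq> {0} \<and> s ` (X closure_of (B' i)) \<subseteq> {1}" for i
  proof -
    have "disjnt (topspace X - B i) (X closure_of (B' i))" using B'(2) by (auto simp: disjnt_def)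
    then show ?thesis
      using Urysohn_lemma[OF paracompact_imp_normal_space[OF X], of "topspace X - B i" "X closure_of (B' i)" 0 1] B(1)
      by (metis closedin_closure_of closedin_diff closedin_topspace zero_le_one)
  qed
  then obtain s where s: "\<And>i. continuous_map X (top_of_set {0..1::real}) (s i)"
    "\<And>i. s i ` (topspace X - B i) \<subseteq> {0}" "\<And>i. s i ` (X closure_of (B' i)) \<subseteq> {1}"
    by metis
  show thesis
  proof (rule that[of s])
    show "X closure_of {x \<in> topspace X. s i x \<noteq> 0} \<subseteq> G i" for i
    proof -
      have "{x \<in> topspace X. s i x \<noteq> 0} \<subseteq> B i" using s(2)[of i] by auto
      then show ?thesis using closure_of_mono B(2) by blast
    qed
    fix x assume x: "x \<in> topspace X"
    then obtain i where "x \<in> B' i" using B'(3) by blast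
    then have "x \<in> X closure_of (B' i)"
      using closure_of_subset[OF openin_subset[OF B'(1)]] by blast
    then show "\<exists>i. s i x = 1" using s(3)[of i] by auto
    obtain N where N: "openin X N" "x \<in> N" "finite {i. B i \<inter> N \<noteq> {}}" using B(4)[OF x] by blast
    have "{i. \<exists>y\<in>N. s i y \<noteq> 0} \<subseteq> {i. B i \<inter> N \<noteq> {}}"
      using s(2) openin_subset[OF N(1)] by blast
    then show "\<exists>N. openin X N \<and> x \<in> N \<and> finite {i. \<exists>y\<in>N. s i y \<noteq> 0}"
      using N finite_subset by blast
  qed (fact s(1))
qed

section \<open>Compact subselections and their local contractions\<close>

text \<open>The last clause is an upper semicontinuity condition: \<open>Q x\<close> absorbs the
  nearby values, so a contraction of the single set \<open>Q x\<close> serves a whole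
  neighbourhood.\<close>

definition compact_subselection ::
  "'x topology \<Rightarrow> ('x \<Rightarrow> 'a::topological_space set) \<Rightarrow> ('x \<Rightarrow> 'a set) \<Rightarrow> bool" where
  "compact_subselection X V Q \<longleftrightarrow> (\<forall>x\<in>topspace X. compact (Q x) \<and> Q x \<subseteq> V x \<and>
     (\<exists>N. openin X N \<and> x \<in> N \<and> (\<forall>y\<in>N. Q y \<subseteq> Q x)))"

text \<open>\<open>D\<close>, \<open>c\<close> and \<open>a\<close> do not depend on
  \<open>x\<close> in \<open>W\<close>, which makes moving a continuous selection along
  \<open>c\<close> continuous in \<open>x\<close>. Membership of \<open>a\<close> is stated
  separately because \<open>D\<close> may be empty, and then the image condition says nothing about
  \<open>a\<close>.\<close>

definition contracts_over ::
  "('x \<Rightarrow> 'a::topological_space set) \<Rightarrow> ('x \<Rightarrow> 'a set) \<Rightarrow> 'x set \<Rightarrow> bool" where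
  "contracts_over Q Q' W \<longleftrightarrow> (\<exists>D c a. continuous_on (D \<times> {0..1::real}) c \<and>
     (\<forall>x\<in>W. Q x \<subseteq> D \<and> c ` (D \<times> {0..1}) \<subseteq> Q' x \<and> a \<in> Q' x) \<and>
     (\<forall>y\<in>D. c (y, 0) = y \<and> c (y, 1) = a))"

lemma contracts_over_subset:
  "contracts_over Q Q' W \<Longrightarrow> W' \<subseteq> W \<Longrightarrow> contracts_over Q Q' W'"
  unfolding contracts_over_def by (meson subsetD)

text \<open>The track of a contraction of \<open>Q x\<close> is compact, hence stays inside
  \<open>V y\<close> for \<open>y\<close> near \<open>x\<close>. Adding to \<open>Q\<close> the
  tracks belonging to a locally finite family of such neighbourhoods keeps the values compact and
  gives room for the contractions.\<close>

lemma compact_subselection_extend: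
  fixes V Q :: "'x \<Rightarrow> 'a::topological_space set"
  assumes X: "paracompact_space X"
    and V: "openin (prod_topology X (top_of_set C)) (\<Union>x\<in>topspace X. {x} \<times> V x)"
    and contr: "\<And>x K. \<lbrakk>x \<in> topspace X; compact K; K \<subseteq> V x\<rbrakk> \<Longrightarrow>
      \<exists>c a. continuous_on (K \<times> {0..1::real}) c \<and> c ` (K \<times> {0..1}) \<subseteq> V x \<and> a \<in> V x \<and>
        (\<forall>y\<in>K. c (y, 0) = y \<and> c (y, 1) = a)"
    and Q: "compact_subselection X V Q"
  shows "\<exists>Q'. compact_subselection X V Q' \<and> (\<forall>x. Q x \<subseteq> Q' x) \<and>
    (\<forall>x\<in>topspace X. \<exists>W. openin X W \<and> x \<in> W \<and> contracts_over Q Q' W)"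
proof -
  have Qx: "compact (Q x)" "Q x \<subseteq> V x" if "x \<in> topspace X" for x
    using Q that unfolding compact_subselection_def by auto
  have "\<forall>x\<in>topspace X. \<exists>c a. continuous_on (Q x \<times> {0..1::real}) c \<and> c ` (Q x \<times> {0..1}) \<subseteq> V x \<and> a \<in> V x \<and>
        (\<forall>y\<in>Q x. c (y, 0) = y \<and> c (y, 1) = a)"
    using contr Qx by blast
  then obtain c a where ca: "\<And>x. x \<in> topspace X \<Longrightarrow> continuous_on (Q x \<times> {0..1::real}) (c x) \<and> c x ` (Q x \<times> {0..1}) \<subseteq> V x \<and> a x \<in> V x \<and>
        (\<forall>y\<in>Q x. c x (y, 0) = y \<and> c x (y, 1) = a x)"
    by metis
  \<comment> \<open>The track of the contraction; the apex is inserted so that it is present even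
    when \<open>Q x\<close> is empty.\<close>
  define B where "B = (\<lambda>x. insert (a x) (c x ` (Q x \<times> {0..1})))"
  have cB: "compact (B x)" if "x \<in> topspace X" for x
    unfolding B_def using ca[OF that] Qx(1)[OF that]
    by (intro compact_insert compact_continuous_image compact_Times) auto
  have VC: "V x \<subseteq> C" if "x \<in> topspace X" for x
    using openin_subset[OF V] that by auto
  have "\<exists>W. openin X W \<and> x \<in> W \<and> (\<forall>y\<in>W. Q y \<subseteq> Q x \<and> B x \<subseteq> V y)" if x: "x \<in> topspace X" for x
  proof -
    have BV: "B x \<subseteq> V x" using ca[OF x] unfolding B_def by auto
    then have "compactin (top_of_set C) (B x)"
      using cB[OF x] VC[OF x] by (auto simp: compactin_subtopology)
    \<comment> \<open>The tube lemma turns compactness of \<open>B x\<close> and openness of the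
      graph of \<open>V\<close> into a neighbourhood of \<open>x\<close> over which
      \<open>B x\<close> remains admissible.\<close>
    then have "\<exists>O1 P. openin X O1 \<and> openin (top_of_set C) P \<and> x \<in> O1 \<and> B x \<subseteq> P \<and>
        O1 \<times> P \<subseteq> (\<Union>x\<in>topspace X. {x} \<times> V x)"
      by (rule tube_lemma_right[OF V _ x]) (use BV x in auto)
    then obtain O1 P where O1: "openin X O1" "x \<in> O1" "B x \<subseteq> P" "O1 \<times> P \<subseteq> (\<Union>x\<in>topspace X. {x} \<times> V x)"
      by blast
    obtain N where N: "openin X N" "x \<in> N" "\<forall>y\<in>N. Q y \<subseteq> Q x"
      using Q x unfolding compact_subselection_def by blast
    have "\<forall>y\<in>O1 \<inter> N. Q y \<subseteq> Q x \<and> B x \<subseteq> V y" using O1(3,4) N(3) by blast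
    then show ?thesis using O1(1,2) N(1,2) by (intro exI[of _ "O1 \<inter> N"]) auto
  qed
  then obtain O' where O': "\<And>x. x \<in> topspace X \<Longrightarrow> openin X (O' x) \<and> x \<in> O' x"
    "\<And>x y. \<lbrakk>x \<in> topspace X; y \<in> O' x\<rbrakk> \<Longrightarrow> Q y \<subseteq> Q x \<and> B x \<subseteq> V y"
    by metis
  obtain \<V> where \<V>: "\<And>W. W \<in> \<V> \<Longrightarrow> openin X W" "topspace X \<subseteq> \<Union>\<V>" "locally_finite_in X \<V>"
    "\<And>W. W \<in> \<V> \<Longrightarrow> \<exists>x\<in>topspace X. X closure_of W \<subseteq> O' x"
    using paracompact_space_closure_refinement[OF X O'(1)] by metis
  obtain p where p: "\<And>W. W \<in> \<V> \<Longrightarrow> p W \<in> topspace X \<and> X closure_of W \<subseteq> O' (p W)"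
    using \<V>(4) by metis
  \<comment> \<open>Using the closures of the \<open>W\<close> rather than the \<open>W\<close>
    themselves makes \<open>Q'\<close> locally decreasing: a track contributing at points
    arbitrarily near \<open>x\<close> also contributes at \<open>x\<close>.\<close>
  define Q' where "Q' = (\<lambda>x. Q x \<union> (\<Union>W\<in>{W\<in>\<V>. x \<in> X closure_of W}. B (p W)))"
  have "compact_subselection X V Q'"
    unfolding compact_subselection_def
  proof (intro ballI conjI)
    fix x assume x: "x \<in> topspace X"
    obtain N0 where N0: "openin X N0" "x \<in> N0" "\<forall>y\<in>N0. Q y \<subseteq> Q x"
      using Q x unfolding compact_subselection_def by blast
    obtain N where N: "openin X N" "x \<in> N" "finite {W \<in> \<V>. W \<inter> N \<noteq> {}}"
      using \<V>(3) x unfolding locally_finite_in_def by blast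
    have meets: "W \<inter> N \<noteq> {}" if "y \<in> N" "y \<in> X closure_of W" for y W
      using that N(1) by (auto simp: in_closure_of)
    have "{W\<in>\<V>. x \<in> X closure_of W} \<subseteq> {W \<in> \<V>. W \<inter> N \<noteq> {}}"
      using meets N(2) by blast
    then have "finite {W\<in>\<V>. x \<in> X closure_of W}" using N(3) by (rule finite_subset)
    then show "compact (Q' x)"
      unfolding Q'_def using p cB Qx(1)[OF x] by (intro compact_Un compact_UN) auto
    show "Q' x \<subseteq> V x"
      unfolding Q'_def using Qx(2)[OF x] p O'(2) by blast
    \<comment> \<open>Only finitely many members meet \<open>N\<close>; removing the closures of
      those whose closure misses \<open>x\<close> leaves an open neighbourhood on which no new track
      appears.\<close>
    let ?\<F> = "{W \<in> \<V>. W \<inter> N \<noteq> {} \<and> x \<notin> X closure_of W}"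
    define N' where "N' = N0 \<inter> N - (\<Union>W\<in>?\<F>. X closure_of W)"
    have "finite ?\<F>" using N(3) by (rule rev_finite_subset) blast
    then have "openin X N'"
      unfolding N'_def using N0(1) N(1) by (intro openin_diff openin_Int closedin_Union) auto
    moreover have "x \<in> N'" using N0(2) N(2) unfolding N'_def by blast
    moreover have "Q' y \<subseteq> Q' x" if y: "y \<in> N'" for y
    proof -
      have "{W\<in>\<V>. y \<in> X closure_of W} \<subseteq> {W\<in>\<V>. x \<in> X closure_of W}"
        using y meets unfolding N'_def by blast
      moreover have "Q y \<subseteq> Q x" using N0(3) y unfolding N'_def by blast
      ultimately show ?thesis unfolding Q'_def by blast
    qed
    ultimately show "\<exists>N. openin X N \<and> x \<in> N \<and> (\<forall>y\<in>N. Q' y \<subseteq> Q' x)" by blast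
  qed
  moreover have "\<forall>x. Q x \<subseteq> Q' x" unfolding Q'_def by blast
  moreover have "\<exists>W. openin X W \<and> x \<in> W \<and> contracts_over Q Q' W" if x: "x \<in> topspace X" for x
  proof -
    obtain W where W: "W \<in> \<V>" "x \<in> W" using \<V>(2) x by blast
    have cl: "y \<in> X closure_of W" if "y \<in> W" for y
      using closure_of_subset[OF openin_subset[OF \<V>(1)[OF W(1)]]] that by blast
    have "contracts_over Q Q' W"
      unfolding contracts_over_def
    proof (intro exI conjI ballI)
      show "continuous_on (Q (p W) \<times> {0..1}) (c (p W))" using ca p W(1) by blast
      show "Q y \<subseteq> Q (p W)" if "y \<in> W" for y using cl[OF that] p[OF W(1)] O'(2) by blast
      have "B (p W) \<subseteq> Q' y" if "y \<in> W" for y using cl[OF that] W(1) unfolding Q'_def by blast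
      then show "c (p W) ` (Q (p W) \<times> {0..1}) \<subseteq> Q' y" "a (p W) \<in> Q' y" if "y \<in> W" for y
        using that unfolding B_def by blast+
    qed (use ca p W(1) in blast)+
    then show ?thesis using W \<V>(1) by blast
  qed
  ultimately show ?thesis by blast
qed

section \<open>Gluing and extending partial selections\<close>

lemma continuous_map_subtopology_locally:
  assumes "\<And>x. x \<in> topspace X \<inter> A \<Longrightarrow>
    \<exists>W. openin X W \<and> x \<in> W \<and> continuous_map (subtopology X (A \<inter> W)) Y g"
  shows "continuous_map (subtopology X A) Y g"
proof -
  obtain W where W: "\<And>x. x \<in> topspace X \<inter> A \<Longrightarrow>
    openin X (W x) \<and> x \<in> W x \<and> continuous_map (subtopology X (A \<inter> W x)) Y g"
    using assms by metis
  show ?thesis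
  proof (rule pasting_lemma[where I = "topspace X \<inter> A" and T = "\<lambda>x. A \<inter> W x" and f = "\<lambda>_. g"])
    show "openin (subtopology X A) (A \<inter> W x)" if "x \<in> topspace X \<inter> A" for x
      using W[OF that] by (simp add: openin_subtopology_Int2)
    show "continuous_map (subtopology (subtopology X A) (A \<inter> W x)) Y g" if "x \<in> topspace X \<inter> A" for x
      using W[OF that] by (simp add: subtopology_subtopology Int_assoc[symmetric])
  qed (use W in auto)
qed

lemma continuous_map_subtopology_Un:
  assumes A: "closedin X A" "continuous_map (subtopology X A) Y g"
    and B: "closedin X B" "continuous_map (subtopology X B) Y g"
  shows "continuous_map (subtopology X (A \<union> B)) Y g"
proof (rule pasting_lemma_closed[where I = "{A, B}" and T = "\<lambda>S. S" and f = "\<lambda>_. g"])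
  show "closedin (subtopology X (A \<union> B)) S" if "S \<in> {A, B}" for S
    using that A(1) B(1) by (intro closedin_subset_topspace) auto
  show "continuous_map (subtopology (subtopology X (A \<union> B)) S) Y g" if "S \<in> {A, B}" for S
  proof -
    have "(A \<union> B) \<inter> S = S" using that by blast
    then show ?thesis using that A(2) B(2) by (auto simp: subtopology_subtopology)
  qed
qed auto

text \<open>Over each \<open>M\<close> in \<open>\<mu>\<close> the value \<open>y x\<close> is moved
  along the contraction for time \<open>s x\<close>. Disjointness makes the choice of
  \<open>M\<close> unambiguous, and the support condition prevents jumps at the boundary of
  \<open>M\<close>. Where \<open>s x = 1\<close> the outcome is the apex, which can be assigned even
  where \<open>y\<close> was not a selection.\<close>

lemma contracts_over_extend:
  fixes Q Q' :: "'x \<Rightarrow> 'a::topological_space set"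
  assumes disj: "pairwise disjnt \<mu>"
    and \<mu>: "\<And>M. M \<in> \<mu> \<Longrightarrow> openin X M" "\<And>M. M \<in> \<mu> \<Longrightarrow> contracts_over Q Q' M"
    and s: "continuous_map X (top_of_set {0..1::real}) s"
      "X closure_of {x \<in> topspace X. s x \<noteq> 0} \<subseteq> \<Union>\<mu>"
    and E: "closedin X E" and y: "continuous_map (subtopology X E) euclidean y"
      "\<And>x. x \<in> E \<Longrightarrow> y x \<in> Q x"
    and QQ': "\<And>x. Q x \<subseteq> Q' x"
  shows "\<exists>y'. continuous_map (subtopology X (E \<union> {x \<in> topspace X. s x = 1})) euclidean y' \<and>
    (\<forall>x \<in> E \<union> {x \<in> topspace X. s x = 1}. y' x \<in> Q' x) \<and> (\<forall>x\<in>E. s x = 0 \<longrightarrow> y' x = y x)"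
proof -
  obtain D c a where Dca: "\<And>M. M \<in> \<mu> \<Longrightarrow> continuous_on (D M \<times> {0..1::real}) (c M) \<and>
     (\<forall>x\<in>M. Q x \<subseteq> D M \<and> c M ` (D M \<times> {0..1}) \<subseteq> Q' x \<and> a M \<in> Q' x) \<and>
     (\<forall>y\<in>D M. c M (y, 0) = y \<and> c M (y, 1) = a M)"
    using \<mu>(2) unfolding contracts_over_def by metis
  define m where "m = (\<lambda>x. THE M. M \<in> \<mu> \<and> x \<in> M)"
  have m: "m x = M" if "M \<in> \<mu>" "x \<in> M" for x M
    unfolding m_def using disj that by (intro the_equality) (auto simp: pairwise_def disjnt_iff)
  \<comment> \<open>Three cases, since \<open>m x\<close> is meaningless off
    \<open>\<Union>\<mu>\<close> and \<open>y x\<close> is uncontrolled off \<open>E\<close>. On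
    \<open>E \<inter> M\<close> all three agree with \<open>c M (y x, s x)\<close>, by the end
    conditions on \<open>c M\<close>.\<close>
  define y' where "y' = (\<lambda>x. if s x = 0 then y x else if s x = 1 then a (m x) else c (m x) (y x, s x))"
  define S where "S = {x \<in> topspace X. s x = 1}"
  have cs: "continuous_map X euclidean s" and s01: "\<And>x. x \<in> topspace X \<Longrightarrow> s x \<in> {0..1}"
    using s(1) by (auto simp: continuous_map_in_subtopology)
  have "closedin X S"
    unfolding S_def using closedin_continuous_map_preimage[OF cs, of "{1}"] by simp
  have EX: "E \<subseteq> topspace X" by (rule closedin_subset[OF E])
  have supp: "\<exists>M\<in>\<mu>. x \<in> M" if "x \<in> topspace X" "s x \<noteq> 0" for x
    using s(2) closure_of_subset[of "{x \<in> topspace X. s x \<noteq> 0}" X] that by blast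
  have onE: "y' x = c M (y x, s x)" if "x \<in> E" "x \<in> M" "M \<in> \<mu>" for x M
  proof -
    have "y x \<in> D M" using Dca[OF that(3)] y(2)[OF that(1)] that(2) by blast
    then show ?thesis using Dca[OF that(3)] m[OF that(3,2)] unfolding y'_def by simp
  qed
  have onS: "y' x = a M" if "x \<in> S" "x \<in> M" "M \<in> \<mu>" for x M
    using m that unfolding y'_def S_def by auto
  have val: "y' x \<in> Q' x" if "x \<in> E \<union> S" for x
  proof (cases "s x = 0")
    case True
    then have "x \<in> E" using that unfolding S_def by auto
    then show ?thesis using True y(2) QQ' unfolding y'_def by auto
  next
    case False
    have x: "x \<in> topspace X" using that EX unfolding S_def by auto
    then obtain M where M: "M \<in> \<mu>" "x \<in> M" using supp False by blast
    show ?thesis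
    proof (cases "x \<in> S")
      case True
      then show ?thesis using onS M Dca by metis
    next
      case False
      then have xE: "x \<in> E" using that by blast
      then have "(y x, s x) \<in> D M \<times> {0..1}" using y(2) Dca[OF M(1)] M(2) s01[OF x] by blast
      then show ?thesis using onE[OF xE M(2,1)] Dca[OF M(1)] M(2) by blast
    qed
  qed
  have "continuous_map (subtopology X (E \<union> S)) euclidean y'"
  proof (rule continuous_map_subtopology_locally)
    fix x assume x: "x \<in> topspace X \<inter> (E \<union> S)"
    \<comment> \<open>Off the closed support of \<open>s\<close> nothing is moved and
      \<open>y'\<close> is locally \<open>y\<close>; on it, the member \<open>M\<close> containing
      \<open>x\<close> is the neighbourhood.\<close>
    show "\<exists>W. openin X W \<and> x \<in> W \<and> continuous_map (subtopology X ((E \<union> S) \<inter> W)) euclidean y'"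
    proof (cases "x \<in> X closure_of {x \<in> topspace X. s x \<noteq> 0}")
      case False
      define W where "W = topspace X - X closure_of {x \<in> topspace X. s x \<noteq> 0}"
      have s0: "s z = 0" if "z \<in> W" for z
        using closure_of_subset[of "{x \<in> topspace X. s x \<noteq> 0}" X] that unfolding W_def by blast
      then have sub: "(E \<union> S) \<inter> W \<subseteq> E" unfolding S_def by force
      have "continuous_map (subtopology X ((E \<union> S) \<inter> W)) euclidean y"
        using continuous_map_from_subtopology_mono[OF y(1) sub] .
      then have "continuous_map (subtopology X ((E \<union> S) \<inter> W)) euclidean y'"
        by (rule continuous_map_eq) (auto simp: y'_def s0)
      moreover have "openin X W" "x \<in> W" using x False unfolding W_def by auto
      ultimately show ?thesis by blast
    next
      case True
      then obtain M where M: "M \<in> \<mu>" "x \<in> M" using s(2) by blast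
      have "continuous_map (subtopology X (E \<inter> M)) (top_of_set (D M \<times> {0..1})) (\<lambda>x. (y x, s x))"
      proof -
        have "continuous_map (subtopology X (E \<inter> M)) (prod_topology euclidean euclidean) (\<lambda>x. (y x, s x))"
          by (intro continuous_map_pairedI continuous_map_from_subtopology[OF cs]
              continuous_map_from_subtopology_mono[OF y(1)]) auto
        moreover have "(y z, s z) \<in> D M \<times> {0..1}" if "z \<in> E \<inter> M" for z
          using that y(2) Dca[OF M(1)] s01 EX by blast
        ultimately show ?thesis
          by (auto simp: continuous_map_in_subtopology)
      qed
      moreover have "continuous_map (top_of_set (D M \<times> {0..1})) euclidean (c M)"
        using Dca[OF M(1)] by simp
      ultimately have cE: "continuous_map (subtopology X (E \<inter> M)) euclidean (\<lambda>x. c M (y x, s x))"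
        by (rule continuous_map_compose[unfolded o_def])
      have "continuous_map (subtopology X (E \<inter> M)) euclidean y'"
        by (rule continuous_map_eq[OF cE]) (use onE M(1) in auto)
      moreover have "continuous_map (subtopology X (S \<inter> M)) euclidean y'"
        by (rule continuous_map_eq[where f = "\<lambda>_. a M"]) (use onS M(1) in auto)
      \<comment> \<open>Within \<open>M\<close> both \<open>E\<close> and \<open>S\<close> are
        relatively closed, so the moved selection and the constant \<open>a M\<close> paste
        together.\<close>
      ultimately have "continuous_map (subtopology (subtopology X M) (M \<inter> E \<union> M \<inter> S)) euclidean y'"
        using E \<open>closedin X S\<close> Int_commute[of E M] Int_commute[of S M]
        by (intro continuous_map_subtopology_Un closedin_subtopology_Int_closed)
          (simp_all add: subtopology_subtopology)
      moreover have "M \<inter> (M \<inter> E \<union> M \<inter> S) = (E \<union> S) \<inter> M" by blast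
      ultimately have "continuous_map (subtopology X ((E \<union> S) \<inter> M)) euclidean y'"
        by (simp add: subtopology_subtopology)
      then show ?thesis using M \<mu>(1) by blast
    qed
  qed
  then show ?thesis using val unfolding S_def by (intro exI[of _ y']) (auto simp: y'_def)
qed

section \<open>The selection theorem over paracompact C-spaces\<close>

text \<open>Convexity and Z-sets enter only through contractibility of compact sets inside the
  values \<open>V x\<close>. Every point lies in some \<open>E n\<close> because some bump function
  equals 1 there, and near each point only finitely many steps change the selection, so the partial
  selections \<open>y n\<close> have a continuous limit.\<close>

lemma C_space_selection:
  fixes V :: "'x \<Rightarrow> 'a::topological_space set"
  assumes X: "paracompact_space X" "C_space X"
    and V: "openin (prod_topology X (top_of_set C)) (\<Union>x\<in>topspace X. {x} \<times> V x)"
    and contr: "\<And>x K. \<lbrakk>x \<in> topspace X; compact K; K \<subseteq> V x\<rbrakk> \<Longrightarrow>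
      \<exists>c a. continuous_on (K \<times> {0..1::real}) c \<and> c ` (K \<times> {0..1}) \<subseteq> V x \<and> a \<in> V x \<and>
        (\<forall>y\<in>K. c (y, 0) = y \<and> c (y, 1) = a)"
  shows "\<exists>f. continuous_map X (top_of_set C) f \<and> (\<forall>x\<in>topspace X. f x \<in> V x)"
proof -
  have "\<exists>Q. \<forall>n. compact_subselection X V (Q n) \<and> ((\<forall>x. Q n x \<subseteq> Q (Suc n) x) \<and>
    (\<forall>x\<in>topspace X. \<exists>W. openin X W \<and> x \<in> W \<and> contracts_over (Q n) (Q (Suc n)) W))"
  proof (rule dependent_nat_choice)
    show "\<exists>Q. compact_subselection X V Q"
      by (intro exI[of _ "\<lambda>_. {}"]) (auto simp: compact_subselection_def)
  qed (use compact_subselection_extend[OF X(1) V contr] in blast)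
  then obtain Q where Q: "\<And>n. compact_subselection X V (Q n)" "\<And>n x. Q n x \<subseteq> Q (Suc n) x"
    "\<And>n x. x \<in> topspace X \<Longrightarrow> \<exists>W. openin X W \<and> x \<in> W \<and> contracts_over (Q n) (Q (Suc n)) W"
    by blast
  define \<alpha> where "\<alpha> = (\<lambda>n. {W. openin X W \<and> contracts_over (Q n) (Q (Suc n)) W})"
  have "\<forall>n. (\<forall>U\<in>\<alpha> n. openin X U) \<and> topspace X \<subseteq> \<Union>(\<alpha> n)"
  proof (intro allI conjI subsetI)
    show "x \<in> \<Union>(\<alpha> n)" if "x \<in> topspace X" for x n
      using Q(3)[OF that, of n] unfolding \<alpha>_def by blast
  qed (auto simp: \<alpha>_def)
  then have "\<exists>\<mu>. (\<forall>n. (\<forall>V\<in>\<mu> n. openin X V) \<and> pairwise disjnt (\<mu> n) \<and>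
      (\<forall>V\<in>\<mu> n. \<exists>U\<in>\<alpha> n. V \<subseteq> U)) \<and> topspace X \<subseteq> (\<Union>n. \<Union>(\<mu> n))"
    by (rule X(2)[unfolded C_space_def, THEN spec, THEN mp])
  then obtain \<mu> where \<mu>_all: "\<forall>n. (\<forall>V\<in>\<mu> n. openin X V) \<and> pairwise disjnt (\<mu> n) \<and>
      (\<forall>V\<in>\<mu> n. \<exists>U\<in>\<alpha> n. V \<subseteq> U)" and \<mu>_cover: "topspace X \<subseteq> (\<Union>n. \<Union>(\<mu> n))"
    by (elim exE conjE)
  have \<mu>: "\<And>n M. M \<in> \<mu> n \<Longrightarrow> openin X M" "\<And>n. pairwise disjnt (\<mu> n)"
    "\<And>n M. M \<in> \<mu> n \<Longrightarrow> \<exists>U\<in>\<alpha> n. M \<subseteq> U"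
    using \<mu>_all by simp_all
  have contr_\<mu>: "contracts_over (Q n) (Q (Suc n)) M" if "M \<in> \<mu> n" for n M
  proof -
    obtain W where "W \<in> \<alpha> n" "M \<subseteq> W" using \<mu>(3)[OF \<open>M \<in> \<mu> n\<close>] by blast
    then show ?thesis unfolding \<alpha>_def by (auto intro: contracts_over_subset)
  qed
  have op\<mu>: "openin X (\<Union>(\<mu> n))" for n using \<mu>(1) by blast
  obtain s :: "nat \<Rightarrow> 'x \<Rightarrow> real" where s: "\<And>i. continuous_map X (top_of_set {0..1}) (s i)"
    "\<And>i. X closure_of {x \<in> topspace X. s i x \<noteq> 0} \<subseteq> \<Union>(\<mu> i)"
    "\<And>x. x \<in> topspace X \<Longrightarrow> \<exists>i. s i x = 1"
    "\<And>x. x \<in> topspace X \<Longrightarrow> \<exists>N. openin X N \<and> x \<in> N \<and> finite {i. \<exists>y\<in>N. s i y \<noteq> 0}"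
    by (rule paracompact_space_bump_functions[OF X(1) op\<mu> \<mu>_cover]) (rule that)
  \<comment> \<open>The domain of the \<open>n\<close>-th partial selection. The strict bound makes
    \<open>E 0\<close> empty, so the induction may start from an arbitrary function.\<close>
  define E where "E = (\<lambda>n. {x \<in> topspace X. \<exists>i<n. s i x = 1})"
  have E0: "E 0 = {}" and ESuc: "E (Suc n) = E n \<union> {x \<in> topspace X. s n x = 1}" for n
    unfolding E_def by (auto simp: less_Suc_eq)
  have closedE: "closedin X (E n)" for n
  proof (induction n)
    case (Suc n)
    have "continuous_map X euclidean (s n)"
      using s(1) by (auto simp: continuous_map_in_subtopology)
    then have "closedin X {x \<in> topspace X. s n x \<in> {1}}"
      by (rule closedin_continuous_map_preimage) simp
    then show ?case using Suc unfolding ESuc by auto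
  qed (simp add: E0)
  have "\<exists>y. \<forall>n. (continuous_map (subtopology X (E n)) euclidean (y n) \<and> (\<forall>x\<in>E n. y n x \<in> Q n x)) \<and>
    (\<forall>x\<in>E n. s n x = 0 \<longrightarrow> y (Suc n) x = y n x)"
  proof (rule dependent_nat_choice)
    show "\<exists>y. continuous_map (subtopology X (E 0)) euclidean y \<and> (\<forall>x\<in>E 0. y x \<in> Q 0 x)"
      unfolding E0 by (intro exI[of _ "\<lambda>_. undefined"]) simp
    fix y n
    assume y: "continuous_map (subtopology X (E n)) euclidean y \<and> (\<forall>x\<in>E n. y x \<in> Q n x)"
    have "\<exists>y'. continuous_map (subtopology X (E n \<union> {x \<in> topspace X. s n x = 1})) euclidean y' \<and>
      (\<forall>x \<in> E n \<union> {x \<in> topspace X. s n x = 1}. y' x \<in> Q (Suc n) x) \<and>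
      (\<forall>x\<in>E n. s n x = 0 \<longrightarrow> y' x = y x)"
      by (rule contracts_over_extend[OF \<mu>(2)[of n] \<mu>(1) contr_\<mu> s(1,2) closedE]) (use y Q(2) in auto)
    then show "\<exists>y'. (continuous_map (subtopology X (E (Suc n))) euclidean y' \<and> (\<forall>x\<in>E (Suc n). y' x \<in> Q (Suc n) x)) \<and>
      (\<forall>x\<in>E n. s n x = 0 \<longrightarrow> y' x = y x)"
      unfolding ESuc by (simp only: conj_assoc)
  qed
  then obtain y where y: "\<And>n. continuous_map (subtopology X (E n)) euclidean (y n)"
    "\<And>n x. x \<in> E n \<Longrightarrow> y n x \<in> Q n x" "\<And>n x. \<lbrakk>x \<in> E n; s n x = 0\<rbrakk> \<Longrightarrow> y (Suc n) x = y n x"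
    by blast
  \<comment> \<open>Once the bump functions vanish from index \<open>n\<close> on, the one equal to
    1 at \<open>x\<close> has a smaller index.\<close>
  have inE: "x \<in> E n" if x: "x \<in> topspace X" and tail: "\<And>i. i \<ge> n \<Longrightarrow> s i x = 0" for x n
  proof -
    obtain i where i: "s i x = 1" using s(3)[OF x] by blast
    then have "i < n" using tail[of i] by (cases "i < n") auto
    then show ?thesis using i x unfolding E_def by blast
  qed
  have const: "y k x = y n x" if "x \<in> topspace X" "\<And>i. i \<ge> n \<Longrightarrow> s i x = 0" "n \<le> k" for x n k
    using that(3)
  proof (induction k rule: dec_induct)
    case (step k)
    have "x \<in> E k" by (rule inE[OF that(1)]) (use that(2) step.hyps in auto)
    then show ?case using y(3)[of x k] that(2)[of k] step by simp
  qed simp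
  have local: "\<exists>N n. openin X N \<and> x \<in> N \<and> (\<forall>z\<in>N. \<forall>i\<ge>n. s i z = 0)" if x: "x \<in> topspace X" for x
  proof -
    obtain N where N: "openin X N" "x \<in> N" "finite {i. \<exists>y\<in>N. s i y \<noteq> 0}" using s(4)[OF x] by blast
    then obtain n where "\<forall>i\<in>{i. \<exists>y\<in>N. s i y \<noteq> 0}. i < n" unfolding finite_nat_set_iff_bounded by blast
    then have "\<forall>z\<in>N. \<forall>i\<ge>n. s i z = 0" using leD by blast
    then show ?thesis using N by blast
  qed
  define m where "m = (\<lambda>x. SOME n. \<forall>i\<ge>n. s i x = 0)"
  have m: "s i x = 0" if "x \<in> topspace X" "i \<ge> m x" for x i
  proof -
    have "\<exists>n. \<forall>i\<ge>n. s i x = 0" using local[OF that(1)] by blast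
    then have "\<forall>i\<ge>m x. s i x = 0" unfolding m_def by (rule someI_ex)
    then show ?thesis using that by blast
  qed
  \<comment> \<open>The stable value at \<open>x\<close>. The index \<open>m x\<close> need not vary
    nicely with \<open>x\<close>; \<open>f_eq\<close> allows it to be replaced by any other index
    beyond which the bump functions vanish at \<open>x\<close>, in particular by one common to a
    neighbourhood.\<close>
  define f where "f = (\<lambda>x. y (m x) x)"
  have f_eq: "f x = y n x" if "x \<in> topspace X" "\<And>i. i \<ge> n \<Longrightarrow> s i x = 0" for x n
  proof -
    have "y (max n (m x)) x = y n x" by (rule const[OF that]) auto
    moreover have "y (max n (m x)) x = y (m x) x" by (rule const[OF that(1) m[OF that(1)]]) auto
    ultimately show ?thesis unfolding f_def by simp
  qed
  have fV: "f x \<in> V x" if x: "x \<in> topspace X" for x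
  proof -
    have "f x \<in> Q (m x) x" unfolding f_def by (intro y(2) inE x m)
    then show ?thesis using Q(1)[of "m x"] x unfolding compact_subselection_def by blast
  qed
  have "continuous_map (subtopology X (topspace X)) euclidean f"
  proof (rule continuous_map_subtopology_locally)
    fix x assume "x \<in> topspace X \<inter> topspace X"
    then have "\<exists>N n. openin X N \<and> x \<in> N \<and> (\<forall>z\<in>N. \<forall>i\<ge>n. s i z = 0)" by (intro local) blast
    then obtain N n where N: "openin X N" "x \<in> N" "\<forall>z\<in>N. \<forall>i\<ge>n. s i z = 0"
      by (elim exE conjE)
    have sub: "topspace X \<inter> N \<subseteq> E n"
    proof
      fix z assume "z \<in> topspace X \<inter> N"
      then show "z \<in> E n" by (intro inE) (use N(3) in auto)
    qed
    have "y n z = f z" if "z \<in> topspace X" "z \<in> N" for z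
      by (rule f_eq[symmetric]) (use that N(3) in auto)
    then have "continuous_map (subtopology X (topspace X \<inter> N)) euclidean f"
      by (intro continuous_map_eq[OF continuous_map_from_subtopology_mono[OF y(1) sub]]) auto
    then show "\<exists>W. openin X W \<and> x \<in> W \<and> continuous_map (subtopology X (topspace X \<inter> W)) euclidean f"
      using N(1,2) by (intro exI[of _ N] conjI)
  qed
  moreover have "V x \<subseteq> C" if "x \<in> topspace X" for x
    using openin_subset[OF V] that by auto
  ultimately have "continuous_map X (top_of_set C) f"
    using fV by (auto simp: continuous_map_in_subtopology)
  then show ?thesis using fV by blast
qed

section \<open>Convex values with Z-sets removed\<close>

theorem theorem2:
  fixes X :: "'x topology" and C :: "'a::banach set"
    and Z U :: "'x \<Rightarrow> 'a set"
  assumes "paracompact_space X" and "C_space X"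
    and "convex C"
    and "\<And>x. x \<in> topspace X \<Longrightarrow> Z_set_in (top_of_set C) (Z x)"
    and "\<And>x. x \<in> topspace X \<Longrightarrow> U x \<noteq> {} \<and> convex (U x) \<and> U x \<subseteq> C"
    and "closedin (prod_topology X (top_of_set C)) (\<Union>x\<in>topspace X. {x} \<times> Z x)"
    and "openin (prod_topology X (top_of_set C)) (\<Union>x\<in>topspace X. {x} \<times> U x)"
  shows "\<exists>f. continuous_map X (top_of_set C) f \<and> (\<forall>x\<in>topspace X. f x \<in> U x - Z x)"
proof (rule C_space_selection[OF assms(1,2)])
  have "(\<Union>x\<in>topspace X. {x} \<times> (U x - Z x)) =
      (\<Union>x\<in>topspace X. {x} \<times> U x) - (\<Union>x\<in>topspace X. {x} \<times> Z x)" by auto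
  then show "openin (prod_topology X (top_of_set C)) (\<Union>x\<in>topspace X. {x} \<times> (U x - Z x))"
    using openin_diff[OF assms(7,6)] by simp
  fix x K assume x: "x \<in> topspace X" and K: "compact K" "K \<subseteq> U x - Z x"
  \<comment> \<open>Slicing the open graph at \<open>x\<close> shows that \<open>U x\<close> is open
    in \<open>C\<close>, as the contraction lemma requires.\<close>
  have "continuous_map (top_of_set C) (prod_topology X (top_of_set C)) (\<lambda>y. (x, y))"
    by (intro continuous_map_pairedI) (use x in auto)
  then have "openin (top_of_set C) {y \<in> topspace (top_of_set C). (x, y) \<in> (\<Union>x\<in>topspace X. {x} \<times> U x)}"
    using assms(7) by (rule openin_continuous_map_preimage)
  moreover have "{y \<in> topspace (top_of_set C). (x, y) \<in> (\<Union>x\<in>topspace X. {x} \<times> U x)} = U x"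
    using x assms(5)[OF x] by auto
  ultimately have "openin (top_of_set C) (U x)" by simp
  then show "\<exists>c a. continuous_on (K \<times> {0..1::real}) c \<and> c ` (K \<times> {0..1}) \<subseteq> U x - Z x \<and> a \<in> U x - Z x \<and>
        (\<forall>y\<in>K. c (y, 0) = y \<and> c (y, 1) = a)"
    using Z_set_in_convex_contraction[OF assms(3) assms(4)[OF x] _ _ _ K] assms(5)[OF x]
    by (metis (no_types, lifting))
qed

end
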